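(* Suppose $r_n\,d_\infty(C_n,C)\to w$ in distribution, where $r_n$ is a strictly increasing sequence, $C_n\in\mathcal K$ is a sequence of random sets, $C\in\mathcal K$ is a deterministic set, and $w$ is a random variable. If $S$ is a Lipschitz continuous set-valued set function, then $$\limsup_n\ \mathbb P\big(r_n\,d_\infty(S(C_n),S(C))\ge u\big)\le\mathbb P(\kappa\cdot w\ge u),$$ where $\kappa\in\mathbb R_+$ is the Lipschitz constant of $S$.
   Context: $\mathcal K$ is the space of compact subsets of a Euclidean space. $d(x,C)=\inf_{y\in C}\|x-y\|$, and $d_\infty(C,D)=\sup_x|d(x,C)-d(x,D)|$ is the Pompeiu–Hausdorff distance. A set-valued set function $G:V\Rightarrow U$ assigns to each set $S\subseteq V$ a set $G(S)\subseteq U$. $G$ is Lipschitz continuous on $V$ with constant $\kappa\in\mathbb R_+$ if it is nonempty- and closed-valued and $G(S')\subseteq G(S)+\kappa\, d_\infty(S',S)\,\mathbb B$ for all $S,S'\subseteq V$ with $S,S'\in\mathcal K$, where $\mathbb B=\{u:\|u\|\le1\}$ is the unit ball. The number $u\in\mathbb R$ in the claim is arbitrary.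
   Formalization: The sequence r_n is additionally assumed nonnegative; with negative r_n the claim fails (r_n = -1-1/(n+1), d_∞(C_n,C) = 1, S constant with κ = 1, w = -1, u = 0). *)

theory Defs
  imports "HOL-Probability.Probability"
begin

text \<open>The empty set is excluded: its distance function is identically \<open>\<infinity>\<close>, so that the
  Pompeiu-Hausdorff distance is a real-valued metric only on the nonempty compact sets.\<close>

definition compacts :: "'a::euclidean_space set set" where
  "compacts = {C. compact C \<and> C \<noteq> {}}"

text \<open>For a nonempty set \<open>C\<close>, \<^term>\<open>infdist x C\<close> is \<open>inf\<^sub>y\<^sub>\<in>\<^sub>C \<parallel>x - y\<parallel>\<close>. The supremum below is one of real
  numbers, hence meaningful only where it is finite. It is finite for two nonempty
  bounded sets, and also for the possibly unbounded values of a Lipschitz continuous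
  set-valued set function at two nonempty compact sets, where it is at most \<open>\<kappa>\<close> times the
  distance of the arguments.\<close>

definition PH_dist :: "'a::euclidean_space set \<Rightarrow> 'a set \<Rightarrow> real" where
  "PH_dist C D = (SUP x. \<bar>infdist x C - infdist x D\<bar>)"

definition set_function ::
    "'a::euclidean_space set \<Rightarrow> 'b::euclidean_space set \<Rightarrow> ('a set \<Rightarrow> 'b set) \<Rightarrow> bool" where
  "set_function V U G \<longleftrightarrow> (\<forall>S. S \<subseteq> V \<longrightarrow> G S \<subseteq> U)"

definition Lipschitz_set_function ::
    "real \<Rightarrow> 'a::euclidean_space set \<Rightarrow> ('a set \<Rightarrow> 'b::euclidean_space set) \<Rightarrow> bool" where
  "Lipschitz_set_function \<kappa> V G \<longleftrightarrow>
     0 \<le> \<kappa> \<and>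
     (\<forall>S. S \<subseteq> V \<longrightarrow> G S \<noteq> {} \<and> closed (G S)) \<and>
     (\<forall>S S'. S \<subseteq> V \<longrightarrow> S' \<subseteq> V \<longrightarrow> S \<in> compacts \<longrightarrow> S' \<in> compacts \<longrightarrow>
        G S' \<subseteq> {y + (\<kappa> * PH_dist S' S) *\<^sub>R v | y v. y \<in> G S \<and> v \<in> cball 0 1})"

text \<open>Measurability of a set-valued map in the usual sense of random set theory: all hitting
  events of open sets are measurable. For nonempty compact values in a Euclidean space this is
  the same as measurability with respect to the Borel sets of the Pompeiu-Hausdorff metric.\<close>

definition random_compact_set :: "'w measure \<Rightarrow> ('w \<Rightarrow> 'a::euclidean_space set) \<Rightarrow> bool" where
  "random_compact_set M X \<longleftrightarrow>
     (\<forall>\<omega>\<in>space M. X \<omega> \<in> compacts) \<and>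
     (\<forall>W. open W \<longrightarrow> {\<omega> \<in> space M. X \<omega> \<inter> W \<noteq> {}} \<in> sets M)"

definition converges_in_distribution ::
    "'w measure \<Rightarrow> (nat \<Rightarrow> 'w \<Rightarrow> real) \<Rightarrow> 'v measure \<Rightarrow> ('v \<Rightarrow> real) \<Rightarrow> bool" where
  "converges_in_distribution M X N w \<longleftrightarrow>
     weak_conv_m (\<lambda>n. distr M borel (X n)) (distr N borel w)"

end

theory Submission
  imports Defs
begin

text \<open>Lipschitz continuity of \<open>S\<close> gives the pathwise bound
  \<open>d\<^sub>\<infinity> (S C\<^sub>n, S C) \<le> \<kappa> d\<^sub>\<infinity> (C\<^sub>n, C)\<close>, so that for \<open>\<kappa> > 0\<close> the event in question is contained in
  \<open>r\<^sub>n d\<^sub>\<infinity> (C\<^sub>n, C) \<ge> u / \<kappa>\<close>, and the closed half-line case of the portmanteau theorem applies. For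
  \<open>\<kappa> = 0\<close> the left-hand event is empty or the right-hand one is everything.\<close>

text \<open>Triangle inequality through the nearby point \<open>b\<close>, then the infimum over
  \<open>a\<close>. This turns a one-sided inclusion up to distance \<open>c\<close> into one half
  of a bound on \<open>\<bar>infdist x A - infdist x B\<bar>\<close>.\<close>

lemma infdist_le_add:
  assumes "A \<noteq> {}" and near: "\<And>a. a \<in> A \<Longrightarrow> \<exists>b\<in>B. dist a b \<le> c"
  shows "infdist x B \<le> infdist x A + c"
proof -
  have "infdist x B - c \<le> dist x a" if "a \<in> A" for a
  proof -
    obtain b where b: "b \<in> B" "dist a b \<le> c" using near[OF \<open>a \<in> A\<close>] by blast
    have "infdist x B \<le> dist x b" using b(1) by (rule infdist_le)
    also have "\<dots> \<le> dist x a + dist a b" by (rule dist_triangle)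
    finally show ?thesis using b(2) by simp
  qed
  then have "infdist x B - c \<le> infdist x A"
    unfolding infdist_notempty[OF \<open>A \<noteq> {}\<close>] using \<open>A \<noteq> {}\<close> by (intro cINF_greatest) auto
  then show ?thesis by simp
qed

text \<open>Rewrites a sublevel condition as the hitting of an open ball, the kind of event that
  \<open>random_compact_set\<close> controls.\<close>

lemma infdist_less_iff:
  assumes "A \<noteq> {}"
  shows "infdist x A < e \<longleftrightarrow> A \<inter> ball x e \<noteq> {}"
  unfolding infdist_notempty[OF assms] using assms
  by (subst cINF_less_iff) auto

lemma PH_dist_commute: "PH_dist C D = PH_dist D C"
  unfolding PH_dist_def by (simp add: abs_minus_commute)

text \<open>Any bound \<open>e\<close> on the diameter of \<open>C \<union> D\<close> bounds the
  difference uniformly in \<open>x\<close>, so the supremum in \<open>PH_dist\<close> is a genuine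
  one.\<close>

lemma bdd_above_infdist_diff:
  assumes "C \<in> compacts" "D \<in> compacts"
  shows "bdd_above (range (\<lambda>x. \<bar>infdist x C - infdist x D\<bar>))"
proof -
  have ne: "C \<noteq> {}" "D \<noteq> {}" and bd: "bounded (C \<union> D)"
    using assms by (auto simp: compacts_def compact_imp_bounded)
  obtain e where e: "\<And>x y. x \<in> C \<union> D \<Longrightarrow> y \<in> C \<union> D \<Longrightarrow> dist x y \<le> e"
    using bd unfolding bounded_two_points by blast
  have "infdist x D \<le> infdist x C + e" "infdist x C \<le> infdist x D + e" for x
    using ne e by (auto intro!: infdist_le_add)
  then have "\<bar>infdist x C - infdist x D\<bar> \<le> e" for x
    by (simp add: abs_le_iff algebra_simps)
  then show ?thesis by (auto intro!: bdd_aboveI)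
qed

lemma PH_dist_le_iff:
  assumes "C \<in> compacts" "D \<in> compacts"
  shows "PH_dist C D \<le> a \<longleftrightarrow> (\<forall>x. \<bar>infdist x C - infdist x D\<bar> \<le> a)"
  unfolding PH_dist_def using bdd_above_infdist_diff[OF assms] by (subst cSUP_le_iff) auto

lemma PH_dist_nonneg:
  assumes "C \<in> compacts" "D \<in> compacts"
  shows "0 \<le> PH_dist C D"
  \<comment> \<open>With the distance itself as the bound, it dominates every absolute value in the
    supremum.\<close>
  using PH_dist_le_iff[OF assms, of "PH_dist C D"] by force

text \<open>Phrased for nonempty sets rather than members of \<open>compacts\<close>, since it is
  applied to values of a set function, which may be unbounded. The uniform bound from the two
  one-sided estimates also shows that the supremum is finite.\<close>

lemma PH_dist_le:
  assumes "A \<noteq> {}" "B \<noteq> {}"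
    and "\<And>a. a \<in> A \<Longrightarrow> \<exists>b\<in>B. dist a b \<le> c"
    and "\<And>b. b \<in> B \<Longrightarrow> \<exists>a\<in>A. dist b a \<le> c"
  shows "PH_dist A B \<le> c"
  unfolding PH_dist_def
proof (rule cSUP_least)
  fix x
  have "infdist x B \<le> infdist x A + c" "infdist x A \<le> infdist x B + c"
    using assms by (auto intro: infdist_le_add)
  then show "\<bar>infdist x A - infdist x B\<bar> \<le> c"
    by (simp add: abs_le_iff algebra_simps)
qed simp

text \<open>The Lipschitz inclusion puts each point of one value within
  \<open>\<kappa> * PH_dist D C\<close> of the other value. Using it in both directions, with the
  symmetry of \<open>PH_dist\<close> to equate the radii, gives the two hypotheses of
  \<open>PH_dist_le\<close>.\<close>

lemma Lipschitz_set_function_PH_dist_le: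
  assumes lip: "Lipschitz_set_function \<kappa> V G"
    and "D \<subseteq> V" "C \<subseteq> V" "D \<in> compacts" "C \<in> compacts"
  shows "PH_dist (G D) (G C) \<le> \<kappa> * PH_dist D C"
proof -
  have near: "\<exists>b\<in>G B. dist a b \<le> \<kappa> * PH_dist A B"
    if AB: "A \<subseteq> V" "B \<subseteq> V" "A \<in> compacts" "B \<in> compacts" and "a \<in> G A" for A B a
  proof -
    have "G A \<subseteq> {y + (\<kappa> * PH_dist A B) *\<^sub>R v | y v. y \<in> G B \<and> v \<in> cball 0 1}"
      using lip AB unfolding Lipschitz_set_function_def by blast
    then obtain y v where y: "y \<in> G B" and v: "norm v \<le> 1"
      and a: "a = y + (\<kappa> * PH_dist A B) *\<^sub>R v" using \<open>a \<in> G A\<close> by auto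
    have nn: "0 \<le> \<kappa> * PH_dist A B"
      using lip PH_dist_nonneg[OF AB(3,4)] by (simp add: Lipschitz_set_function_def)
    have "dist a y = (\<kappa> * PH_dist A B) * norm v" using nn by (simp add: a dist_norm)
    also have "\<dots> \<le> \<kappa> * PH_dist A B" using nn v by (rule mult_left_le[rotated])
    finally show ?thesis using y by blast
  qed
  have "G D \<noteq> {}" "G C \<noteq> {}"
    using lip assms(2,3) unfolding Lipschitz_set_function_def by blast+
  then show ?thesis
    using near[OF assms(2,3,4,5)] near[OF assms(3,2,5,4)]
    by (intro PH_dist_le) (auto simp: PH_dist_commute[of C D])
qed

text \<open>Each strict sublevel set is the hitting event of an open ball.\<close>

lemma borel_measurable_infdist_random_compact_set:
  assumes "random_compact_set M X"
  shows "(\<lambda>\<omega>. infdist x (X \<omega>)) \<in> borel_measurable M"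
  unfolding borel_measurable_iff_less
proof
  fix e :: real
  have "X \<omega> \<noteq> {}" if "\<omega> \<in> space M" for \<omega>
    using assms that by (auto simp: random_compact_set_def compacts_def)
  then have "{\<omega> \<in> space M. infdist x (X \<omega>) < e} = {\<omega> \<in> space M. X \<omega> \<inter> ball x e \<noteq> {}}"
    by (intro Collect_cong conj_cong refl infdist_less_iff)
  then show "{\<omega> \<in> space M. infdist x (X \<omega>) < e} \<in> sets M"
    using assms by (simp add: random_compact_set_def)
qed

text \<open>By continuity of \<open>infdist\<close> the supremum may be taken over a countable dense set.\<close>

lemma borel_measurable_PH_dist_random_compact_set:
  fixes X :: "'w \<Rightarrow> 'a::euclidean_space set"
  assumes X: "random_compact_set M X" and C: "C \<in> compacts"
  shows "(\<lambda>\<omega>. PH_dist (X \<omega>) C) \<in> borel_measurable M"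
  unfolding borel_measurable_iff_le
proof
  fix a :: real
  obtain Q :: "'a set" where Q: "countable Q" and dense: "closure Q = UNIV"
    using separable by (metis closure_subset subset_UNIV top.extremum_uniqueI)
  have "PH_dist (X \<omega>) C \<le> a \<longleftrightarrow> (\<forall>x\<in>Q. \<bar>infdist x (X \<omega>) - infdist x C\<bar> \<le> a)"
    if "\<omega> \<in> space M" for \<omega>
  proof -
    have K: "X \<omega> \<in> compacts" using X that by (simp add: random_compact_set_def)
    have "\<bar>infdist x (X \<omega>) - infdist x C\<bar> \<le> a"
      if "\<forall>x\<in>Q. \<bar>infdist x (X \<omega>) - infdist x C\<bar> \<le> a" for x
    proof (rule continuous_le_on_closure[where S = Q])
      show "continuous_on (closure Q) (\<lambda>x. \<bar>infdist x (X \<omega>) - infdist x C\<bar>)"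
        by (intro continuous_intros)
    qed (use that dense in auto)
    then show ?thesis using PH_dist_le_iff[OF K C] by blast
  qed
  then have "{\<omega> \<in> space M. PH_dist (X \<omega>) C \<le> a} =
      {\<omega> \<in> space M. \<forall>x\<in>Q. \<bar>infdist x (X \<omega>) - infdist x C\<bar> \<le> a}"
    by blast
  also have "\<dots> \<in> sets M"
  proof (rule sets.sets_Collect_countable_All'[OF _ Q])
    fix x
    note [measurable] = borel_measurable_infdist_random_compact_set[OF X]
    show "{\<omega> \<in> space M. \<bar>infdist x (X \<omega>) - infdist x C\<bar> \<le> a} \<in> sets M"
      by measurable
  qed
  finally show "{\<omega> \<in> space M. PH_dist (X \<omega>) C \<le> a} \<in> sets M" .
qed

text \<open>Continuity from above: the open half-lines starting at \<open>t - 1 / (k + 1)\<close>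
  decrease to \<open>{t..}\<close>, so their measures tend to that of \<open>{t..}\<close>.\<close>

lemma (in finite_borel_measure) obtain_interval_close_atLeast:
  assumes "0 < e"
  obtains s where "s < t" "measure M {s<..} < measure M {t..} + e"
proof -
  let ?A = "\<lambda>k. {t + - inverse (real (Suc k))<..}"
  have "(\<lambda>k. measure M (?A k)) \<longlonglongrightarrow> measure M (\<Inter>k. ?A k)"
  proof (rule finite_Lim_measure_decseq)
    show "decseq ?A" by (auto simp: decseq_Suc_iff field_simps)
  qed auto
  moreover have "(\<Inter>k. ?A k) = {t..}"
  proof (intro equalityI subsetI)
    fix x assume x: "x \<in> (\<Inter>k. ?A k)"
    have "(\<lambda>k. t + - inverse (real (Suc k))) \<longlonglongrightarrow> t" by (rule LIMSEQ_inverse_real_of_nat_add_minus)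
    then have "t \<le> x" using x by (intro LIMSEQ_le_const2) (auto intro: less_imp_le)
    then show "x \<in> {t..}" by simp
  next
    fix x assume "x \<in> {t..}"
    then show "x \<in> (\<Inter>k. ?A k)" by (auto intro: less_le_trans[of _ t])
  qed
  ultimately have "(\<lambda>k. measure M (?A k)) \<longlonglongrightarrow> measure M {t..}" by simp
  from order_tendstoD(2)[OF this, of "measure M {t..} + e"] \<open>0 < e\<close>
  obtain k where "measure M (?A k) < measure M {t..} + e"
    by (auto simp: eventually_sequentially)
  then show thesis by (intro that[of "t + - inverse (real (Suc k))"]) auto
qed

text \<open>Transfers convergence of distribution functions, the content of
  \<open>weak_conv_m\<close>, to upper tails.\<close>

lemma (in real_distribution) measure_greaterThan: "measure M {v<..} = 1 - cdf M v"
proof -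
  have "{v<..} = space M - {..v}" by auto
  then show ?thesis using prob_compl[of "{..v}"] by (simp only: cdf_def) simp
qed

text \<open>The distribution functions converge only at continuity points of
  \<open>cdf \<nu>\<close>, and \<open>t\<close> may be an atom. So \<open>{t..}\<close> is enlarged
  to \<open>{v<..}\<close> for a continuity point \<open>v\<close> slightly below \<open>t\<close>,
  which costs less than \<open>e\<close> in the limit.\<close>

lemma weak_conv_m_limsup_atLeast:
  fixes \<mu> :: "nat \<Rightarrow> real measure"
  assumes D: "\<And>n. real_distribution (\<mu> n)" "real_distribution \<nu>" and conv: "weak_conv_m \<mu> \<nu>"
  shows "limsup (\<lambda>n. ereal (measure (\<mu> n) {t..})) \<le> ereal (measure \<nu> {t..})"
proof (rule ereal_le_epsilon2)
  fix e :: real assume "0 < e"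
  interpret \<nu>: real_distribution \<nu> by fact
  obtain s where s: "s < t" "measure \<nu> {s<..} < measure \<nu> {t..} + e"
    using \<nu>.obtain_interval_close_atLeast[of e t] \<open>0 < e\<close> by auto
  \<comment> \<open>The discontinuities of \<open>cdf \<nu>\<close> are the atoms of
    \<open>\<nu>\<close>, and there are only countably many.\<close>
  have "uncountable ({s<..<t} - {x. \<not> isCont (cdf \<nu>) x})"
    using s(1) \<nu>.countable_atoms
    by (intro uncountable_minus_countable) (auto simp: uncountable_open_interval \<nu>.isCont_cdf zero_less_measure_iff)
  then obtain v where v: "s < v" "v < t" "isCont (cdf \<nu>) v"
    by (metis (mono_tags, lifting) DiffE countable_empty equals0I greaterThanLessThan_iff
        mem_Collect_eq)
  have "(\<lambda>n. cdf (\<mu> n) v) \<longlonglongrightarrow> cdf \<nu> v"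
    using conv v(3) by (simp add: weak_conv_m_def weak_conv_def)
  then have "(\<lambda>n. measure (\<mu> n) {v<..}) \<longlonglongrightarrow> measure \<nu> {v<..}"
    by (simp add: real_distribution.measure_greaterThan D tendsto_diff)
  then have lim: "limsup (\<lambda>n. ereal (measure (\<mu> n) {v<..})) = ereal (measure \<nu> {v<..})"
    by (intro lim_imp_Limsup) auto
  have mono: "measure (\<mu> n) {t..} \<le> measure (\<mu> n) {v<..}" for n
  proof -
    interpret real_distribution "\<mu> n" by (rule D)
    show ?thesis using v by (intro finite_measure_mono) auto
  qed
  have "limsup (\<lambda>n. ereal (measure (\<mu> n) {t..})) \<le> limsup (\<lambda>n. ereal (measure (\<mu> n) {v<..}))"
    by (intro Limsup_mono always_eventually) (simp add: mono)
  also have "\<dots> \<le> ereal (measure \<nu> {s<..})"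
    using v unfolding lim by (simp, intro \<nu>.finite_measure_mono) auto
  also have "\<dots> \<le> ereal (measure \<nu> {t..}) + ereal e"
    using s(2) by simp
  finally show "limsup (\<lambda>n. ereal (measure (\<mu> n) {t..})) \<le> ereal (measure \<nu> {t..}) + ereal e" .
qed

theorem proposition3:
  fixes M :: "'w measure" and N :: "'v measure"
    and V :: "'a::euclidean_space set" and U :: "'b::euclidean_space set"
    and S :: "'a set \<Rightarrow> 'b set" and \<kappa> :: real
    and Cn :: "nat \<Rightarrow> 'w \<Rightarrow> 'a set" and C :: "'a set"
    and r :: "nat \<Rightarrow> real" and w :: "'v \<Rightarrow> real" and u :: real
  assumes "prob_space M" and "prob_space N"
    and "strict_mono r" and "\<And>n. 0 \<le> r n"
    and "\<And>n. random_compact_set M (Cn n)"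
    and "\<And>n \<omega>. \<omega> \<in> space M \<Longrightarrow> Cn n \<omega> \<subseteq> V"
    and "C \<in> compacts" and "C \<subseteq> V"
    and "w \<in> borel_measurable N"
    and "converges_in_distribution M (\<lambda>n \<omega>. r n * PH_dist (Cn n \<omega>) C) N w"
    and "set_function V U S"
    and "Lipschitz_set_function \<kappa> V S"
  shows "limsup (\<lambda>n. ereal (\<P>(\<omega> in M. r n * PH_dist (S (Cn n \<omega>)) (S C) \<ge> u)))
           \<le> ereal (\<P>(\<omega> in N. \<kappa> * w \<omega> \<ge> u))"
proof -
  interpret M: prob_space M by fact
  interpret N: prob_space N by fact
  note [measurable] = \<open>w \<in> borel_measurable N\<close>
  let ?X = "\<lambda>n \<omega>. r n * PH_dist (Cn n \<omega>) C"
  \<comment> \<open>This makes \<open>distr M borel (?X n)\<close> a real probability law, as the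
    portmanteau bound requires.\<close>
  have X [measurable]: "?X n \<in> borel_measurable M" for n
    using borel_measurable_PH_dist_random_compact_set[OF assms(5,7)] by simp
  have \<kappa>: "0 \<le> \<kappa>" using assms(12) by (simp add: Lipschitz_set_function_def)
  have le: "r n * PH_dist (S (Cn n \<omega>)) (S C) \<le> \<kappa> * ?X n \<omega>" if "\<omega> \<in> space M" for n \<omega>
  proof -
    have "Cn n \<omega> \<in> compacts" using assms(5) that by (auto simp: random_compact_set_def)
    then have "PH_dist (S (Cn n \<omega>)) (S C) \<le> \<kappa> * PH_dist (Cn n \<omega>) C"
      using assms(6-8,12) that by (intro Lipschitz_set_function_PH_dist_le) auto
    \<comment> \<open>Nonnegativity of \<open>r n\<close> preserves the direction of the
      inequality.\<close>
    from mult_left_mono[OF this assms(4)[of n]] show ?thesis by (simp add: algebra_simps)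
  qed
  show ?thesis
  proof (cases "\<kappa> = 0")
    case True
    show ?thesis
    proof (cases "u \<le> 0")
      case True
      then show ?thesis using \<open>\<kappa> = 0\<close>
        by (auto simp: N.prob_space intro!: Limsup_bounded always_eventually)
    next
      case False
      \<comment> \<open>For \<open>\<kappa> = 0\<close> the pathwise bound \<open>le\<close> has
        right-hand side \<open>0\<close>, which lies below \<open>u\<close>.\<close>
      then have "{\<omega> \<in> space M. r n * PH_dist (S (Cn n \<omega>)) (S C) \<ge> u} = {}" for n
        using le[of _ n] \<open>\<kappa> = 0\<close> by force
      then show ?thesis by (simp only: measure_empty) (simp add: Limsup_const)
    qed
  next
    case False
    with \<kappa> have "0 < \<kappa>" by simp
    then have scale: "u \<le> \<kappa> * x \<longleftrightarrow> u / \<kappa> \<le> x" for x by (simp add: field_simps)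
    \<comment> \<open>The event on the left need not be measurable; its measure is then the junk value \<open>0\<close>, and
      \<open>finite_measure_mono\<close> only asks for measurability of the larger event.\<close>
    have "\<P>(\<omega> in M. r n * PH_dist (S (Cn n \<omega>)) (S C) \<ge> u)
        \<le> measure (distr M borel (?X n)) {u / \<kappa>..}" for n
    proof -
      have "\<P>(\<omega> in M. r n * PH_dist (S (Cn n \<omega>)) (S C) \<ge> u) \<le> \<P>(\<omega> in M. u / \<kappa> \<le> ?X n \<omega>)"
        using le[of _ n] by (intro M.finite_measure_mono) (auto simp flip: scale intro: order_trans)
      also have "\<dots> = measure (distr M borel (?X n)) {u / \<kappa>..}"
        by (subst measure_distr) (auto intro!: arg_cong[where f = "measure M"])
      finally show ?thesis .
    qed
    then have "limsup (\<lambda>n. ereal (\<P>(\<omega> in M. r n * PH_dist (S (Cn n \<omega>)) (S C) \<ge> u)))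
        \<le> limsup (\<lambda>n. ereal (measure (distr M borel (?X n)) {u / \<kappa>..}))"
      by (intro Limsup_mono always_eventually) simp
    also have "\<dots> \<le> ereal (measure (distr N borel w) {u / \<kappa>..})"
      using assms(10) unfolding converges_in_distribution_def
      by (intro weak_conv_m_limsup_atLeast) (simp_all add: M.real_distribution_distr
          N.real_distribution_distr)
    also have "measure (distr N borel w) {u / \<kappa>..} = \<P>(\<omega> in N. \<kappa> * w \<omega> \<ge> u)"
      by (subst measure_distr) (auto simp: scale intro!: arg_cong[where f = "measure N"])
    finally show ?thesis .
  qed
qed

end
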